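(* Let $P\in\mathbb{Z}$ with $P>1$, let $\chi_0\ge 0$, and let $g:\mathbb{Z}\to\mathbb{R}$ be the impulse response of a causal system (so $g(t)=0$ for $t<0$) with $\sum_{t\in\mathbb{Z}}|g(t)|<\infty$, whose support is an infinite interval $\{k,k+1,k+2,\dots\}$ for some $k\in\mathbb{Z}_{\ge 0}$, and which is strictly monotonically decreasing on its support. Let $u:\mathbb{Z}\to\mathbb{R}$ be $P$-periodic with $S_c^-(\Delta_c u^P)=2$ and $S_c^+(\mathrm{rel}_{\chi_0}(u^P))=2$, and let $o^P=-H_{\overline g^P}\,\mathrm{rel}_{\chi_0}(u^P)$. If $$P_p(\mathrm{rel}_{\chi_0}(u^P))=P_p(\mathrm{rel}_{\chi_0}(o^P))\quad\text{and}\quad P_n(\mathrm{rel}_{\chi_0}(u^P))=P_n(\mathrm{rel}_{\chi_0}(o^P)),$$ then $$P_p(\mathrm{rel}_{\chi_0}(u^P))=P_n(\mathrm{rel}_{\chi_0}(u^P)).$$ If additionally $P_z(\mathrm{rel}_{\chi_0}(u^P))=0$, then $$P=2P_p(\mathrm{rel}_{\chi_0}(u^P))=2P_p(\mathrm{rel}_{\chi_0}(o^P))=2P_p(u^P)=2P_p(o^P).$$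
   Context: Support: $\mathrm{supp}(g)=\{i\in\mathbb{Z}: g(i)\neq 0\}$. Truncation: for a $P$-periodic sequence $x:\mathbb{Z}\to\mathbb{R}$, $x^P=[x(0),\dots,x(P-1)]^\top\in\mathbb{R}^P$. Periodic summation: $\overline g(t)=\sum_{i\in\mathbb{Z}}g(t+iP)$, which is $P$-periodic; $\overline g^P$ is its truncation. Circulant matrix: for $v\in\mathbb{R}^n$, $H_v\in\mathbb{R}^{n\times n}$ has $(i,j)$ entry $v_{((i-j)\bmod n)+1}$, i.e. its first column is $v$ and each next column is the cyclic down-shift of the previous one. Relay with dead zone: for $\chi_0\ge 0$ and $x\in\mathbb{R}$, $\mathrm{rel}_{\chi_0}(x)=1$ if $x>\chi_0$, $-1$ if $x<-\chi_0$, and $0$ otherwise; applied entrywise to vectors. Cyclic forward difference: for $v\in\mathbb{R}^n$, $\Delta_c v=[v_2-v_1,\,v_3-v_2,\dots,v_n-v_{n-1},\,v_1-v_n]^\top$. Variation: for $v\neq 0$, $S^-(v)$ is the number of sign changes between consecutive entries of the vector obtained from $v$ by deleting all zeros; $S^-(0)=-1$. Cyclic variation: $S_c^-(v)=\max_{1\le i\le n}S^-([v_i,\dots,v_n,v_1,\dots,v_i])$. $S_c^+(v)$ is the maximum of $S_c^-(\bar v)$ over all $\bar v\in\mathbb{R}^n$ obtained from $v$ by replacing its zero entries by arbitrary real numbers. Counts: $P_p(v)$, $P_n(v)$, $P_z(v)$ are the numbers of positive, negative, and zero entries of $v$, respectively. *)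

theory Defs
  imports "HOL-Analysis.Infinite_Sum" "Jordan_Normal_Form.Matrix"
begin

text \<open>
  Vectors of R^n are elements of \<^typ>\<open>real vec\<close> of dimension n; their entries are indexed
  by 0, ..., n - 1, so the i-th entry in one-based notation is the entry with index i - 1.
\<close>

definition supp :: "(int \<Rightarrow> real) \<Rightarrow> int set" where
  "supp g = {i. g i \<noteq> 0}"

definition periodic :: "nat \<Rightarrow> (int \<Rightarrow> real) \<Rightarrow> bool" where
  "periodic P x \<longleftrightarrow> (\<forall>t. x (t + int P) = x t)"

definition trunc :: "nat \<Rightarrow> (int \<Rightarrow> real) \<Rightarrow> real vec" where
  "trunc P x = vec P (\<lambda>i. x (int i))"

text \<open>
  As usual for \<^const>\<open>infsum\<close>, the value is meaningful only where the family is summable,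
  which holds for every t when g is absolutely summable and P is positive.
\<close>

definition periodic_sum :: "nat \<Rightarrow> (int \<Rightarrow> real) \<Rightarrow> int \<Rightarrow> real" where
  "periodic_sum P g t = (\<Sum>\<^sub>\<infinity>i::int. g (t + i * int P))"

text \<open>The difference of indices is taken in the integers, since it may be negative.\<close>

definition circulant :: "real vec \<Rightarrow> real mat" where
  "circulant v = mat (dim_vec v) (dim_vec v)
     (\<lambda>(i, j). v $ nat ((int i - int j) mod int (dim_vec v)))"

definition rel :: "real \<Rightarrow> real \<Rightarrow> real" where
  "rel \<chi> x = (if x > \<chi> then 1 else if x < - \<chi> then - 1 else 0)"

definition rel_vec :: "real \<Rightarrow> real vec \<Rightarrow> real vec" where
  "rel_vec \<chi> v = map_vec (rel \<chi>) v"

definition cyclic_diff :: "real vec \<Rightarrow> real vec" where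
  "cyclic_diff v = vec (dim_vec v) (\<lambda>i. v $ (Suc i mod dim_vec v) - v $ i)"

text \<open>
  The variation is defined on lists because it is also applied to the vectors of dimension
  n + 1 that arise from a vector of dimension n by a cyclic shift and repetition of an entry.
\<close>

definition sign_changes :: "real list \<Rightarrow> nat" where
  "sign_changes xs = card {i. Suc i < length xs \<and> xs ! i * xs ! Suc i < 0}"

definition variation :: "real list \<Rightarrow> int" where
  "variation xs = (let ys = filter (\<lambda>x. x \<noteq> 0) xs
                   in if ys = [] then - 1 else int (sign_changes ys))"

definition cyclic_variation :: "real vec \<Rightarrow> int" where
  "cyclic_variation v = (let xs = list_of_vec v in
     Max ((\<lambda>i. variation (drop i xs @ take (Suc i) xs)) ` {..<dim_vec v}))"

definition zero_fillings :: "real vec \<Rightarrow> real vec set" where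
  "zero_fillings v = {w. dim_vec w = dim_vec v \<and> (\<forall>i<dim_vec v. v $ i \<noteq> 0 \<longrightarrow> w $ i = v $ i)}"

definition cyclic_variation_plus :: "real vec \<Rightarrow> int" where
  "cyclic_variation_plus v = Max (cyclic_variation ` zero_fillings v)"

definition num_pos :: "real vec \<Rightarrow> nat" where
  "num_pos v = card {i. i < dim_vec v \<and> v $ i > 0}"

definition num_neg :: "real vec \<Rightarrow> nat" where
  "num_neg v = card {i. i < dim_vec v \<and> v $ i < 0}"

definition num_zero :: "real vec \<Rightarrow> nat" where
  "num_zero v = card {i. i < dim_vec v \<and> v $ i = 0}"

text \<open>
  There are infinitely many zero fillings, but their cyclic variations form a finite set, so
  that the \<^const>\<open>Max\<close> above is a genuine maximum.
\<close>

lemma variation_bounds: "- 1 \<le> variation xs \<and> variation xs \<le> int (length xs)"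
proof -
  let ?ys = "filter (\<lambda>x. x \<noteq> 0) xs"
  have "sign_changes ?ys \<le> card {..<length ?ys}"
    unfolding sign_changes_def by (rule card_mono) auto
  also have "card {..<length ?ys} \<le> length xs" by simp
  finally have "sign_changes ?ys \<le> length xs" .
  then show ?thesis unfolding variation_def Let_def by simp
qed

lemma cyclic_variation_bounds:
  assumes "dim_vec v > 0"
  shows "cyclic_variation v \<in> {- 1..int (dim_vec v) + 1}"
proof -
  let ?ys = "\<lambda>i. drop i (list_of_vec v) @ take (Suc i) (list_of_vec v)"
  have "cyclic_variation v \<in> (\<lambda>i. variation (?ys i)) ` {..<dim_vec v}"
    unfolding cyclic_variation_def Let_def
    by (rule Max_in) (use assms in auto)
  then obtain i where i: "i < dim_vec v" and eq: "cyclic_variation v = variation (?ys i)"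
    by blast
  have "length (?ys i) = dim_vec v + 1"
    using i by simp
  then show ?thesis
    using variation_bounds[of "?ys i"] unfolding eq by simp
qed

lemma finite_cyclic_variation_zero_fillings:
  assumes "dim_vec v > 0"
  shows "finite (cyclic_variation ` zero_fillings v)"
proof (rule finite_subset)
  show "cyclic_variation ` zero_fillings v \<subseteq> {- 1..int (dim_vec v) + 1}"
  proof (rule image_subsetI)
    fix w assume "w \<in> zero_fillings v"
    then have "dim_vec w = dim_vec v" unfolding zero_fillings_def by simp
    then show "cyclic_variation w \<in> {- 1..int (dim_vec v) + 1}"
      using cyclic_variation_bounds[of w] assms by simp
  qed
qed simp

end

theory Submission
  imports Defs "HOL-Number_Theory.Cong"
begin

text \<open>
  Write w for the relay output over one period, p and n for its numbers of positive and negative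
  entries. The idea is to compare the feedback output o with its own shift by half a period
  d = P div 2. Suppose p > n. Then w(j) + w(j + d) is never negative
  (\<open>half_shift_sum_nonneg\<close>): the negative entries of w occupy so short an arc of the
  period that the half-period shift carries them into the positive entries. The periodic summation
  of g is nonnegative, because a decreasing summable sequence is
  (\<open>decreasing_summable_nonneg\<close>), and cyclic convolution commutes with shifts.
  Convolving and negating therefore gives o(t) + o(t + d) \<open>\<le>\<close> 0, so the shift maps
  \<open>{o > \<chi>}\<close> injectively into \<open>{o < - \<chi>}\<close> and o has at most as many
  entries above the dead zone as below it (\<open>feedback_flips_majority\<close>). Since the relay
  applied to o has p positive and n negative entries, p \<open>\<le>\<close> n, a contradiction. The
  case p < n is the same with all signs reversed. If the relay output has no zeros, then
  P = p + n = 2 p, and no entry of u or o lies in the dead zone, so that the relay does not change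
  the number of positive entries.

  The bound on the cyclic variation enters in a weak form: read along one period, w does not have
  four entries that alternate between \<open>\<ge>\<close> 0 and \<open>\<le>\<close> 0
  (\<open>not_weakly_alternating\<close>). If w(j) + w(j + d) were negative,
  then one of the two arcs between these entries would be wholly negative, which forces
  n \<open>\<ge>\<close> p.
\<close>

section \<open>Weak alternation\<close>

text \<open>
  The inequalities are weak because a zero entry may be filled with either sign. The factor
  \<open>\<sigma>\<close> lets the pattern start with either sign, which makes the notion invariant under
  negation, so that a negative majority reduces to a positive one.
\<close>

definition weakly_alternating :: "real vec \<Rightarrow> bool" where
  "weakly_alternating w \<longleftrightarrow> (\<exists>\<sigma>\<in>{-1, 1}. \<exists>a b c d. a < b \<and> b < c \<and> c < d \<and> d < dim_vec w \<and>
     0 \<le> \<sigma> * w $ a \<and> \<sigma> * w $ b \<le> 0 \<and> 0 \<le> \<sigma> * w $ c \<and> \<sigma> * w $ d \<le> 0)"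

lemma weakly_alternatingI:
  assumes "\<sigma> \<in> {-1, 1}" "a < b" "b < c" "c < d" "d < dim_vec w"
    "0 \<le> \<sigma> * w $ a" "\<sigma> * w $ b \<le> 0" "0 \<le> \<sigma> * w $ c" "\<sigma> * w $ d \<le> 0"
  shows "weakly_alternating w"
  unfolding weakly_alternating_def by (intro bexI exI conjI) (fact assms)+

lemma weakly_alternating_uminus: "weakly_alternating (- w) \<longleftrightarrow> weakly_alternating w"
proof -
  have imp: "weakly_alternating (- v)" if alt: "weakly_alternating v" for v
  proof -
    obtain \<sigma> a b c d where "\<sigma> \<in> {-1, 1}" "a < b" "b < c" "c < d" "d < dim_vec v"
      "0 \<le> \<sigma> * v $ a" "\<sigma> * v $ b \<le> 0" "0 \<le> \<sigma> * v $ c" "\<sigma> * v $ d \<le> 0"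
      using alt unfolding weakly_alternating_def by (elim bexE exE conjE) (rule that)
    then show ?thesis
      by (intro weakly_alternatingI[of "- \<sigma>" a b c d]) auto
  qed
  show ?thesis using imp[of w] imp[of "- w"] unfolding uminus_uminus_vec by blast
qed

text \<open>
  This is a discrete intermediate value theorem: without a sign change between neighbours,
  all values keep the sign of the first one.
\<close>

lemma sign_change_between:
  fixes f :: "nat \<Rightarrow> real"
  assumes "a < b" and opp: "f a * f b < 0" and nz: "\<And>m. a \<le> m \<Longrightarrow> m \<le> b \<Longrightarrow> f m \<noteq> 0"
  shows "\<exists>m\<in>{a..<b}. f m * f (Suc m) < 0"
proof (rule ccontr)
  assume no: "\<not> ?thesis"
  have "m \<le> b \<longrightarrow> f a * f m > 0" if "a \<le> m" for m
    using that
  proof (induction m rule: dec_induct)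
    case base
    show ?case using nz[of a] by (auto simp: zero_less_mult_iff)
  next
    case (step m)
    have "f m * f (Suc m) > 0" if le: "Suc m \<le> b"
    proof -
      have "\<not> f m * f (Suc m) < 0" using no step.hyps le by auto
      moreover have "f m \<noteq> 0" "f (Suc m) \<noteq> 0" using nz step.hyps le by auto
      ultimately show ?thesis by (simp add: less_le not_less)
    qed
    then show ?case using step.IH by (auto simp: zero_less_mult_iff)
  qed
  from this[of b] show False using assms(1) opp by auto
qed

lemma variation_ge_3:
  assumes nz: "0 \<notin> set xs" and ord: "a < b" "b < c" "c < d" "d < length xs"
    and opp: "xs ! a * xs ! b < 0" "xs ! b * xs ! c < 0" "xs ! c * xs ! d < 0"
  shows "3 \<le> variation xs"
proof -
  have nz': "xs ! m \<noteq> 0" if "m \<le> d" for m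
    using nz that ord(4) by (metis le_less_trans nth_mem)
  obtain p where p: "a \<le> p" "p < b" "xs ! p * xs ! Suc p < 0"
    using sign_change_between[of a b "(!) xs"] ord opp nz' by auto
  obtain q where q: "b \<le> q" "q < c" "xs ! q * xs ! Suc q < 0"
    using sign_change_between[of b c "(!) xs"] ord opp nz' by auto
  obtain r where r: "c \<le> r" "r < d" "xs ! r * xs ! Suc r < 0"
    using sign_change_between[of c d "(!) xs"] ord opp nz' by auto
  have "card {p, q, r} \<le> sign_changes xs"
    unfolding sign_changes_def
    by (rule card_mono[OF finite_subset[of _ "{..<length xs}"]]) (use p q r ord in auto)
  moreover have "card {p, q, r} = 3" using p q r by auto
  moreover have "filter (\<lambda>x. x \<noteq> 0) xs = xs" using nz by (auto simp: filter_id_conv)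
  moreover have "xs \<noteq> []" using ord by auto
  ultimately show ?thesis by (simp add: variation_def)
qed

text \<open>
  Four weakly alternating entries can be made strictly alternating by filling zeros. If all other
  zeros are filled as well, no entry is deleted in the count of sign changes, and the three changes
  inside one period already exceed the bound.
\<close>

lemma not_weakly_alternating:
  assumes "cyclic_variation_plus w \<le> 2"
  shows "\<not> weakly_alternating w"
proof
  assume "weakly_alternating w"
  then obtain \<sigma> a b c d where s: "\<sigma> \<in> {-1, 1}"
    and ord: "a < b" "b < c" "c < d" "d < dim_vec w"
    and alt: "0 \<le> \<sigma> * w $ a" "\<sigma> * w $ b \<le> 0" "0 \<le> \<sigma> * w $ c" "\<sigma> * w $ d \<le> 0"
    unfolding weakly_alternating_def by (elim bexE exE conjE) (rule that)
  define v where "v = vec (dim_vec w)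
    (\<lambda>i. if w $ i \<noteq> 0 then w $ i else if i \<in> {b, d} then - \<sigma> else \<sigma>)"
  have v: "v \<in> zero_fillings w" by (auto simp: v_def zero_fillings_def)
  let ?xs = "list_of_vec v"
  have dim: "dim_vec v = dim_vec w" by (simp add: v_def)
  have pos: "dim_vec w > 0" using ord by simp
  have "cyclic_variation v \<le> 2"
    using Max_ge[OF finite_cyclic_variation_zero_fillings[OF pos]] v assms
    unfolding cyclic_variation_plus_def by fastforce
  moreover have "variation (drop 0 ?xs @ take (Suc 0) ?xs) \<le> cyclic_variation v"
    unfolding cyclic_variation_def Let_def
    by (intro Max_ge imageI) (use pos dim in auto)
  moreover have "3 \<le> variation (?xs @ take (Suc 0) ?xs)"
  proof (rule variation_ge_3[OF _ ord(1-3)])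
    have "0 \<notin> set ?xs"
      using s by (auto simp: set_list_of_vec vec_set_def v_def)
    then show "0 \<notin> set (?xs @ take (Suc 0) ?xs)"
      by (auto dest: in_set_takeD)
    have nth: "(?xs @ take (Suc 0) ?xs) ! i = v $ i" if "i < dim_vec w" for i
      using that dim by (simp add: nth_append list_of_vec_index)
    have signs: "0 < \<sigma> * v $ a" "\<sigma> * v $ b < 0" "0 < \<sigma> * v $ c" "\<sigma> * v $ d < 0"
      using s ord alt by (auto simp: v_def)
    show "d < length (?xs @ take (Suc 0) ?xs)" using ord dim by simp
    show "(?xs @ take (Suc 0) ?xs) ! a * (?xs @ take (Suc 0) ?xs) ! b < 0"
      "(?xs @ take (Suc 0) ?xs) ! b * (?xs @ take (Suc 0) ?xs) ! c < 0"
      "(?xs @ take (Suc 0) ?xs) ! c * (?xs @ take (Suc 0) ?xs) ! d < 0"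
      using s signs ord by (auto simp: nth mult_less_0_iff)
  qed
  ultimately show False by simp
qed

section \<open>The half-period shift\<close>

text \<open>
  If the inequality fails at j, then both entries are nonpositive and one of them is negative. If
  both arcs that they cut out of the period contained a nonnegative entry, the four entries would
  alternate weakly. So one arc A, of length at least d - 1 for d = P div 2, is wholly negative.
  This gives at least card A + 1 negative entries and leaves at most P - card A - 2 positive ones,
  which is no majority.
\<close>

lemma half_shift_sum_nonneg:
  assumes vals: "\<And>i. i < dim_vec w \<Longrightarrow> w $ i \<in> {-1, 0, 1}"
    and nalt: "\<not> weakly_alternating w" and maj: "num_neg w < num_pos w"
    and j: "j < dim_vec w"
  shows "0 \<le> w $ j + w $ ((j + dim_vec w div 2) mod dim_vec w)"
proof (rule ccontr)
  let ?P = "dim_vec w" let ?d = "?P div 2"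
  let ?k = "(j + ?d) mod ?P"
  assume neg: "\<not> 0 \<le> w $ j + w $ ?k"
  have k: "?k < ?P" using j by simp
  have jk: "w $ j \<le> 0" "w $ ?k \<le> 0" "w $ j < 0 \<or> w $ ?k < 0"
    using vals[OF j] vals[OF k] neg by auto
  have keq: "?k = (if j + ?d < ?P then j + ?d else j + ?d - ?P)"
  proof (cases "j + ?d < ?P")
    case False
    then have "?k = (j + ?d - ?P) mod ?P" by (intro le_mod_geq) simp
    also have "\<dots> = j + ?d - ?P" using j by (intro mod_less) linarith
    finally show ?thesis using False by (simp only: if_False)
  qed (simp only: mod_less if_True)
  \<comment> \<open>The distance of the two entries inside the period is d, or P - d if the shift wraps
    around; P - d is d or d + 1.\<close>
  define x y where "x = min j ?k" and "y = max j ?k"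
  have xy: "x \<le> y" "y < ?P" "w $ x \<le> 0" "w $ y \<le> 0" "w $ x < 0 \<or> w $ y < 0"
    using jk j k by (auto simp: x_def y_def min_def max_def)
  have dist: "?d \<le> y - x" "y - x + ?d \<le> ?P"
    using j unfolding x_def y_def keq by auto
  have bound: False if arc: "A \<subseteq> {i. i < ?P \<and> w $ i < 0} - {x, y}" "card A + 1 \<ge> ?d" "x \<noteq> y" for A
  proof -
    have fin: "finite A" using arc(1) by (rule finite_subset) auto
    obtain z where z: "z \<in> {x, y}" "w $ z < 0" using xy by blast
    have "card (insert z A) \<le> num_neg w"
      unfolding num_neg_def by (rule card_mono) (use z xy arc in auto)
    moreover have "z \<notin> A" using arc z by auto
    ultimately have n: "card A + 1 \<le> num_neg w" using fin by simp
    have "num_pos w + card (insert x (insert y A)) =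
      card ({i. i < ?P \<and> w $ i > 0} \<union> insert x (insert y A))"
      unfolding num_pos_def
      by (rule card_Un_disjoint[symmetric]) (use fin xy arc in auto)
    also have "\<dots> \<le> card {..<?P}"
      by (rule card_mono) (use xy arc in auto)
    also have "\<dots> = ?P" by simp
    finally have "num_pos w + card (insert x (insert y A)) \<le> ?P" .
    moreover have "card (insert x (insert y A)) = card A + 2"
      using fin arc by (subst card_insert_disjoint; (subst card_insert_disjoint)?) auto
    ultimately show False using n maj arc(2) by linarith
  qed
  \<comment> \<open>In a period of length 1 the shift is trivial and both entries coincide.\<close>
  have P2: "?P \<ge> 2"
  proof (rule ccontr)
    assume "\<not> ?P \<ge> 2"
    then have P1: "?P = 1" using j by simp
    then have "num_pos w = 0" using jk j by (auto simp: num_pos_def)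
    then show False using maj by simp
  qed
  then have ne: "x < y" using dist xy(1) by linarith
  consider (inner) "\<And>i. x < i \<Longrightarrow> i < y \<Longrightarrow> w $ i < 0"
    | (outer) "\<And>i. i < x \<or> y < i \<Longrightarrow> i < ?P \<Longrightarrow> w $ i < 0"
    | (both) p q where "x < p" "p < y" "w $ p \<ge> 0" "q < x \<or> y < q" "q < ?P" "w $ q \<ge> 0"
    by (meson not_less)
  then show False
  proof cases
    case inner
    show False
      by (rule bound[of "{x<..<y}"]) (use inner xy ne dist in auto)
  next
    case outer
    have "card ({..<x} \<union> {y<..<?P}) = x + (?P - Suc y)"
      by (subst card_Un_disjoint) (use ne in auto)
    then show False
      by (intro bound[of "{..<x} \<union> {y<..<?P}"]) (use outer xy ne dist in auto)
  next
    case (both p q)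
    from both(4) show False
    proof
      assume "q < x"
      then have "weakly_alternating w"
        using both xy by (intro weakly_alternatingI[of 1 q x p y]) auto
      then show False using nalt by simp
    next
      assume "y < q"
      then have "weakly_alternating w"
        using both xy by (intro weakly_alternatingI[of "-1" x p y q]) auto
      then show False using nalt by simp
    qed
  qed
qed

section \<open>Sign counts and the relay\<close>

lemma num_pos_neg_zero: "num_pos v + num_neg v + num_zero v = dim_vec v"
proof -
  let ?A = "{i. i < dim_vec v \<and> v $ i > 0}" and ?B = "{i. i < dim_vec v \<and> v $ i < 0}"
    and ?C = "{i. i < dim_vec v \<and> v $ i = 0}"
  have "card (?A \<union> ?B \<union> ?C) = card ?A + card ?B + card ?C"
    by (subst card_Un_disjoint; (subst card_Un_disjoint)?) auto
  moreover have "?A \<union> ?B \<union> ?C = {..<dim_vec v}" by auto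
  ultimately show ?thesis unfolding num_pos_def num_neg_def num_zero_def by simp
qed

lemma num_pos_rel_vec:
  "0 \<le> \<chi> \<Longrightarrow> num_pos (rel_vec \<chi> v) = card {i. i < dim_vec v \<and> v $ i > \<chi>}"
  unfolding num_pos_def rel_vec_def by (rule arg_cong[where f = card]) (auto simp: rel_def split: if_splits)

lemma num_neg_rel_vec:
  "0 \<le> \<chi> \<Longrightarrow> num_neg (rel_vec \<chi> v) = card {i. i < dim_vec v \<and> v $ i < - \<chi>}"
  unfolding num_neg_def rel_vec_def by (rule arg_cong[where f = card]) (auto simp: rel_def split: if_splits)

lemma num_pos_uminus: "num_pos (- v) = num_neg v"
  unfolding num_neg_def num_pos_def by (rule arg_cong[where f = card]) auto

lemma num_neg_uminus: "num_neg (- v) = num_pos v"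
  unfolding num_neg_def num_pos_def by (rule arg_cong[where f = card]) auto

lemma rel_vec_uminus: "0 \<le> \<chi> \<Longrightarrow> rel_vec \<chi> (- v) = - rel_vec \<chi> v"
  by (rule eq_vecI) (auto simp: rel_vec_def rel_def)

text \<open>
  A zero entry after the relay is one in the dead zone; without such entries, exceeding the
  threshold and being positive are the same.
\<close>

lemma num_pos_rel_vec_eq:
  assumes "0 \<le> \<chi>" and "num_zero (rel_vec \<chi> v) = 0"
  shows "num_pos (rel_vec \<chi> v) = num_pos v"
proof -
  have "rel \<chi> (v $ i) \<noteq> 0" if "i < dim_vec v" for i
    using assms(2) that by (auto simp: num_zero_def rel_vec_def)
  then have "v $ i > 0 \<longleftrightarrow> v $ i > \<chi>" if "i < dim_vec v" for i
    using assms(1) that by (fastforce simp: rel_def split: if_splits)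
  then show ?thesis
    unfolding num_pos_rel_vec[OF assms(1)] unfolding num_pos_def
    by (intro arg_cong[where f = card]) auto
qed

section \<open>Cyclic convolution\<close>

lemma bij_betw_cyclic_shift:
  "bij_betw (\<lambda>i. (i + d) mod n) {..<n} {..<n::nat}"
proof (rule bij_betw_imageI)
  show inj: "inj_on (\<lambda>i. (i + d) mod n) {..<n}"
    by (rule inj_onI) (metis cong_add_rcancel_nat cong_def cong_less_modulus_unique_nat lessThan_iff)
  show "(\<lambda>i. (i + d) mod n) ` {..<n} = {..<n}"
    by (rule endo_inj_surj[OF _ _ inj]) auto
qed

lemma circulant_mult_vec_nth:
  assumes "dim_vec w = dim_vec c" "i < dim_vec c"
  shows "(circulant c *\<^sub>v w) $ i =
    (\<Sum>j<dim_vec c. c $ nat ((int i - int j) mod int (dim_vec c)) * w $ j)"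
  using assms by (simp add: circulant_def scalar_prod_def atLeast0LessThan)

text \<open>
  Cyclic convolution commutes with cyclic shifts, since the kernel depends on the difference of
  the two indices only.
\<close>

lemma circulant_mult_vec_shift:
  assumes "dim_vec w = dim_vec c" "i < dim_vec c"
  shows "(circulant c *\<^sub>v w) $ ((i + d) mod dim_vec c) =
    (\<Sum>j<dim_vec c. c $ nat ((int i - int j) mod int (dim_vec c)) * w $ ((j + d) mod dim_vec c))"
proof -
  let ?n = "dim_vec c"
  have "(circulant c *\<^sub>v w) $ ((i + d) mod ?n) =
    (\<Sum>j<?n. c $ nat ((int ((i + d) mod ?n) - int j) mod int ?n) * w $ j)"
    using assms by (intro circulant_mult_vec_nth) auto
  also have "\<dots> = (\<Sum>j<?n. c $ nat ((int ((i + d) mod ?n) - int ((j + d) mod ?n)) mod int ?n)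
      * w $ ((j + d) mod ?n))"
    by (rule sum.reindex_bij_betw[OF bij_betw_cyclic_shift, symmetric])
  also have "\<dots> = (\<Sum>j<?n. c $ nat ((int i - int j) mod int ?n) * w $ ((j + d) mod ?n))"
    by (simp add: zmod_int mod_diff_eq)
  finally show ?thesis .
qed

text \<open>
  As c is nonnegative, the sum of an output entry and its half-period shift is minus a
  nonnegative combination of the sums w(j) + w(j + d). An output above \<open>\<chi>\<close> therefore
  has a partner below \<open>- \<chi>\<close>.
\<close>

lemma feedback_flips_majority:
  assumes nonneg: "\<And>i. i < dim_vec c \<Longrightarrow> 0 \<le> c $ i"
    and dim: "dim_vec w = dim_vec c"
    and vals: "\<And>i. i < dim_vec w \<Longrightarrow> w $ i \<in> {-1, 0, 1}"
    and nalt: "\<not> weakly_alternating w" and maj: "num_neg w < num_pos w"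
    and "0 \<le> \<chi>"
  shows "num_pos (rel_vec \<chi> (- (circulant c *\<^sub>v w)))
    \<le> num_neg (rel_vec \<chi> (- (circulant c *\<^sub>v w)))"
proof -
  let ?n = "dim_vec c" let ?y = "- (circulant c *\<^sub>v w)"
  let ?s = "\<lambda>i. (i + ?n div 2) mod ?n"
  have dimy: "dim_vec ?y = ?n" by (simp add: circulant_def)
  have le: "?y $ (?s i) \<le> - ?y $ i" if i: "i < ?n" for i
  proof -
    have "0 \<le> (\<Sum>j<?n. c $ nat ((int i - int j) mod int ?n) * (w $ j + w $ (?s j)))"
      using half_shift_sum_nonneg[OF vals nalt maj] dim i
      by (intro sum_nonneg mult_nonneg_nonneg nonneg) (auto simp: nat_less_iff)
    also have "\<dots> = (circulant c *\<^sub>v w) $ i + (circulant c *\<^sub>v w) $ (?s i)"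
      using circulant_mult_vec_nth[OF dim i] circulant_mult_vec_shift[OF dim i]
      by (simp add: distrib_left sum.distrib)
    finally show ?thesis using i dimy by simp
  qed
  have inj: "inj_on ?s {..<?n}" using bij_betw_cyclic_shift by (rule bij_betw_imp_inj_on)
  have "card {i. i < ?n \<and> ?y $ i > \<chi>} \<le> card {i. i < ?n \<and> ?y $ i < - \<chi>}"
  proof (rule card_inj_on_le[of ?s])
    show "inj_on ?s {i. i < ?n \<and> ?y $ i > \<chi>}" by (rule inj_on_subset[OF inj]) auto
    show "?s ` {i. i < ?n \<and> ?y $ i > \<chi>} \<subseteq> {i. i < ?n \<and> ?y $ i < - \<chi>}"
    proof (rule image_subsetI)
      fix i assume "i \<in> {i. i < ?n \<and> ?y $ i > \<chi>}"
      then have "i < ?n" "?y $ i > \<chi>" by auto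
      then show "?s i \<in> {i. i < ?n \<and> ?y $ i < - \<chi>}"
        using le[of i] by simp
    qed
  qed simp
  then show ?thesis
    using \<open>0 \<le> \<chi>\<close> dimy by (simp only: num_pos_rel_vec num_neg_rel_vec)
qed

section \<open>Decreasing summable sequences\<close>

text \<open>
  A negative value would bound all later values away from zero, against summability.
\<close>

lemma decreasing_summable_nonneg:
  fixes g :: "int \<Rightarrow> real"
  assumes "(\<lambda>t. \<bar>g t\<bar>) summable_on UNIV" and mono: "antimono_on {k..} g" and "k \<le> t"
  shows "0 \<le> g t"
proof (rule ccontr)
  assume neg: "\<not> 0 \<le> g t"
  have "(\<lambda>s. \<bar>g s\<bar>) summable_on {t..}"
    using assms(1) by (rule summable_on_subset_banach) simp
  then have "(\<lambda>s. - g t) summable_on {t..}"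
  proof (rule summable_on_comparison_test)
    fix s assume "s \<in> {t..}"
    then have "g s \<le> g t" using mono \<open>k \<le> t\<close> by (auto simp: monotone_on_def)
    then show "- g t \<le> \<bar>g s\<bar>" by linarith
  qed (use neg in auto)
  moreover have "infinite {t..}" by (simp add: infinite_Ici)
  ultimately show False
    using neg infsum_diverge_constant[of "{t..}" "- g t"] by simp
qed

section \<open>Balance of the relay output\<close>

theorem theorem2:
  fixes P :: nat and \<chi>\<^sub>0 :: real and g u :: "int \<Rightarrow> real" and o\<^sub>P :: "real vec"
  assumes "P > 1"
    and "\<chi>\<^sub>0 \<ge> 0"
    and causal: "\<forall>t<0. g t = 0"
    and summable: "(\<lambda>t. \<bar>g t\<bar>) summable_on UNIV"
    and support: "\<exists>k\<ge>0. supp g = {k..}"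
    and decreasing: "strict_antimono_on (supp g) g"
    and "periodic P u"
    and "cyclic_variation (cyclic_diff (trunc P u)) = 2"
    and "cyclic_variation_plus (rel_vec \<chi>\<^sub>0 (trunc P u)) = 2"
    and out: "o\<^sub>P = - (circulant (trunc P (periodic_sum P g)) *\<^sub>v rel_vec \<chi>\<^sub>0 (trunc P u))"
    and "num_pos (rel_vec \<chi>\<^sub>0 (trunc P u)) = num_pos (rel_vec \<chi>\<^sub>0 o\<^sub>P)"
    and "num_neg (rel_vec \<chi>\<^sub>0 (trunc P u)) = num_neg (rel_vec \<chi>\<^sub>0 o\<^sub>P)"
  shows "num_pos (rel_vec \<chi>\<^sub>0 (trunc P u)) = num_neg (rel_vec \<chi>\<^sub>0 (trunc P u)) \<and>
    (num_zero (rel_vec \<chi>\<^sub>0 (trunc P u)) = 0 \<longrightarrow>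
       P = 2 * num_pos (rel_vec \<chi>\<^sub>0 (trunc P u)) \<and>
       P = 2 * num_pos (rel_vec \<chi>\<^sub>0 o\<^sub>P) \<and>
       P = 2 * num_pos (trunc P u) \<and>
       P = 2 * num_pos o\<^sub>P)"
proof -
  let ?c = "trunc P (periodic_sum P g)"
  let ?w = "rel_vec \<chi>\<^sub>0 (trunc P u)"
  have dimw: "dim_vec ?w = P" "dim_vec ?c = P" by (simp_all add: rel_vec_def trunc_def)
  have dimo: "dim_vec o\<^sub>P = P" unfolding out by (simp add: circulant_def trunc_def)
  have g_nonneg: "0 \<le> g t" for t
  proof -
    obtain k where k: "supp g = {k..}" using support by blast
    have "antimono_on {k..} g"
      using decreasing unfolding k monotone_on_def by (metis order_le_less)
    then have "0 \<le> g t" if "k \<le> t"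
      using that by (rule decreasing_summable_nonneg[OF summable])
    moreover have "g t = 0" if "\<not> k \<le> t" using k that unfolding supp_def by auto
    ultimately show ?thesis by fastforce
  qed
  have c_nonneg: "0 \<le> ?c $ i" if "i < dim_vec ?c" for i
    using that g_nonneg by (auto simp: trunc_def periodic_sum_def intro!: infsum_nonneg)
  have vals: "?w $ i \<in> {-1, 0, 1}" if "i < dim_vec ?w" for i
    using that by (auto simp: rel_vec_def rel_def)
  have nalt: "\<not> weakly_alternating ?w"
    using assms(9) by (intro not_weakly_alternating) simp
  have eq: "num_pos ?w = num_neg ?w"
  proof (rule ccontr)
    assume "num_pos ?w \<noteq> num_neg ?w"
    then consider "num_neg ?w < num_pos ?w" | "num_neg (- ?w) < num_pos (- ?w)"
      by (force simp: num_pos_uminus num_neg_uminus)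
    then show False
    proof cases
      case 1
      from feedback_flips_majority[OF c_nonneg _ vals nalt 1 \<open>0 \<le> \<chi>\<^sub>0\<close>] 1 assms(11,12)
      show False using dimw unfolding out by simp
    next
      case 2
      have "circulant ?c *\<^sub>v (- ?w) = - (circulant ?c *\<^sub>v ?w)"
        using dimw by (intro eq_vecI) (auto simp: circulant_def)
      moreover have "\<not> weakly_alternating (- ?w)" using nalt by (simp add: weakly_alternating_uminus)
      moreover have "(- ?w) $ i \<in> {-1, 0, 1}" if "i < dim_vec (- ?w)" for i
        using vals[of i] that by auto
      ultimately have "num_pos (rel_vec \<chi>\<^sub>0 (- o\<^sub>P)) \<le> num_neg (rel_vec \<chi>\<^sub>0 (- o\<^sub>P))"
        using feedback_flips_majority[OF c_nonneg, of "- ?w" \<chi>\<^sub>0] 2 dimw \<open>0 \<le> \<chi>\<^sub>0\<close>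
        unfolding out by auto
      then show False
        using 2 assms(11,12) \<open>0 \<le> \<chi>\<^sub>0\<close>
        by (simp add: rel_vec_uminus num_pos_uminus num_neg_uminus)
    qed
  qed
  moreover have "P = 2 * num_pos ?w \<and> P = 2 * num_pos (rel_vec \<chi>\<^sub>0 o\<^sub>P) \<and>
       P = 2 * num_pos (trunc P u) \<and> P = 2 * num_pos o\<^sub>P" if z: "num_zero ?w = 0"
  proof -
    have cnt: "num_pos v + num_neg v + num_zero v = dim_vec v" for v
      by (rule num_pos_neg_zero)
    have P: "P = 2 * num_pos ?w" using cnt[of ?w] z eq dimw by simp
    then have zo: "num_zero (rel_vec \<chi>\<^sub>0 o\<^sub>P) = 0"
      using cnt[of "rel_vec \<chi>\<^sub>0 o\<^sub>P"] eq assms(11,12) dimo by (simp add: rel_vec_def)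
    show ?thesis
      using P assms(11) num_pos_rel_vec_eq[OF \<open>0 \<le> \<chi>\<^sub>0\<close> z] num_pos_rel_vec_eq[OF \<open>0 \<le> \<chi>\<^sub>0\<close> zo] by simp
  qed
  ultimately show ?thesis by blast
qed

end
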